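(* Let $Y$ and $\overline{Y}$ be two systems of $N$ competing Brownian particles with common drift coefficients $(g_k)_{1 \le k \le N}$ and diffusion coefficients $(\sigma_k^2)_{1 \le k \le N}$, but with parameters of collision $(q^{\pm}_k)_{1 \le k \le N}$ and $(\overline{q}^{\pm}_k)_{1 \le k \le N}$, respectively, such that $\overline{q}^+_n \ge q^+_n$ for $n = 1, \ldots, N$. Suppose $Y(0) = \overline{Y}(0)$ and the driving Brownian motions are the same for these two systems. Then $$Y(t) \le \overline{Y}(t), \quad t \ge 0.$$
   Context: Vectors are compared componentwise. $\mathcal{W}_N := \{y \in \mathbb{R}^N \mid y_1 \le \ldots \le y_N\}$. Parameters of collision for $N$ particles are real numbers $q^{\pm}_1, \ldots, q^{\pm}_N$ with $q^+_{k+1} + q^-_k = 1$ for $k = 1, \ldots, N-1$ and $0 < q^{\pm}_k < 1$ for $k = 1, \ldots, N$. System of $N$ competing Brownian particles: on a filtered probability space satisfying the usual conditions, take i.i.d. standard Brownian motions $B_1,\ldots,B_N$ (driving Brownian motions), real numbers $g_1,\ldots,g_N$ (drift coefficients), positive reals $\sigma_1,\ldots,\sigma_N$ (diffusion coefficients $\sigma_k^2$), and parameters of collision $(q^{\pm}_k)$. The system is a continuous adapted $\mathcal{W}_N$-valued process $Y = (Y_1,\ldots,Y_N)'$ together with continuous adapted processes $L_{(1,2)},\ldots,L_{(N-1,N)}$ such that, with $L_{(0,1)} \equiv 0 \equiv L_{(N,N+1)}$, $$Y_k(t) = Y_k(0) + g_k t + \sigma_k B_k(t) + q^+_k L_{(k-1,k)}(t)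 - q^-_k L_{(k,k+1)}(t),\quad k=1,\ldots,N,\ t\ge 0,$$ where each $L_{(k,k+1)}$ is nondecreasing, starts from $0$, and can increase only when $Y_k = Y_{k+1}$. It exists in the strong sense and is pathwise unique. *)

theory Defs
  imports "HOL-Probability.Probability"
begin

text \<open>
  Time is the half-line \<open>t \<ge> 0\<close> inside \<^typ>\<open>real\<close>. The library's \<^locale>\<open>filtration\<close> is indexed by a
  whole type; a filtration on the half-line extends to it by \<open>F t = F 0\<close> for \<open>t < 0\<close>, and nothing
  below looks at negative times in any other way.
\<close>

locale usual_filtered_prob_space =
  prob_space M + complete_measure M + filtration "space M" F
  for M :: "'a measure" and F :: "real \<Rightarrow> 'a measure" +
  assumes subalgebra_F: "0 \<le> t \<Longrightarrow> subalgebra M (F t)"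
    and null_sets_F: "null_sets M \<subseteq> sets (F 0)"
    and right_continuous_F: "0 \<le> t \<Longrightarrow> sets (F t) = (\<Inter>s\<in>{t<..}. sets (F s))"
begin

definition adapted :: "(real \<Rightarrow> 'a \<Rightarrow> real) \<Rightarrow> bool" where
  "adapted X \<longleftrightarrow> (\<forall>t\<ge>0. X t \<in> borel_measurable (F t))"

definition continuous_paths :: "(real \<Rightarrow> 'a \<Rightarrow> real) \<Rightarrow> bool" where
  "continuous_paths X \<longleftrightarrow> (AE \<omega> in M. continuous_on {0..} (\<lambda>t. X t \<omega>))"

definition standard_brownian_motion :: "(real \<Rightarrow> 'a \<Rightarrow> real) \<Rightarrow> bool" where
  "standard_brownian_motion B \<longleftrightarrow>
     adapted B \<and> continuous_paths B \<and> (AE \<omega> in M. B 0 \<omega> = 0) \<and>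
     (\<forall>s t. 0 \<le> s \<and> s < t \<longrightarrow>
        distributed M lborel (\<lambda>\<omega>. B t \<omega> - B s \<omega>) (normal_density 0 (sqrt (t - s))) \<and>
        indep_set (sets (F s)) (sets (vimage_algebra (space M) (\<lambda>\<omega>. B t \<omega> - B s \<omega>) borel)))"

text \<open>
  Independence is that of the whole processes, as random elements of the path space; being
  identically distributed is part of each one being a standard Brownian motion.
\<close>

definition iid_brownian_motions :: "nat \<Rightarrow> (nat \<Rightarrow> real \<Rightarrow> 'a \<Rightarrow> real) \<Rightarrow> bool" where
  "iid_brownian_motions N B \<longleftrightarrow>
     (\<forall>k\<in>{1..N}. standard_brownian_motion (B k)) \<and>
     indep_vars (\<lambda>_. PiM {0..} (\<lambda>_. borel)) (\<lambda>k \<omega>. \<lambda>t\<in>{0..}. B k t \<omega>) {1..N}"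

end

text \<open>Vectors of length \<open>N\<close> are functions on \<^typ>\<open>nat\<close> read at the indices \<open>1, \<dots>, N\<close> only.\<close>

definition weyl_chamber :: "nat \<Rightarrow> (nat \<Rightarrow> real) set" where
  "weyl_chamber N = {y. \<forall>k. 1 \<le> k \<and> k < N \<longrightarrow> y k \<le> y (Suc k)}"

definition collision_parameters :: "nat \<Rightarrow> (nat \<Rightarrow> real) \<Rightarrow> (nat \<Rightarrow> real) \<Rightarrow> bool" where
  "collision_parameters N qp qm \<longleftrightarrow>
     (\<forall>k. 1 \<le> k \<and> k < N \<longrightarrow> qp (Suc k) + qm k = 1) \<and>
     (\<forall>k\<in>{1..N}. 0 < qp k \<and> qp k < 1 \<and> 0 < qm k \<and> qm k < 1)"

text \<open>
  \<open>L k\<close> stands for the collision term \<open>L\<^bsub>(k,k+1)\<^esub>\<close>, so that \<open>L 0\<close> and \<open>L N\<close> are the two vanishing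
  boundary terms. All requirements on paths are almost sure. That \<open>L k\<close> can increase only when
  \<open>Y k = Y (Suc k)\<close> is stated as: the Stieltjes measure \<open>dL k\<close> is carried by the set of such times;
  the \<open>max 0\<close> continues \<open>L k\<close> as a constant to negative times, where \<open>dL k\<close> has no mass.
\<close>

locale competing_brownian_particles = usual_filtered_prob_space M F
  for M :: "'a measure" and F :: "real \<Rightarrow> 'a measure" +
  fixes N :: nat
    and g \<sigma> qp qm :: "nat \<Rightarrow> real"
    and B Y L :: "nat \<Rightarrow> real \<Rightarrow> 'a \<Rightarrow> real"
  assumes N_pos: "1 \<le> N"
    and sigma_pos: "k \<in> {1..N} \<Longrightarrow> 0 < \<sigma> k"
    and collision: "collision_parameters N qp qm"
    and driving: "iid_brownian_motions N B"
    and Y_adapted: "k \<in> {1..N} \<Longrightarrow> adapted (Y k)"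
    and Y_continuous: "k \<in> {1..N} \<Longrightarrow> continuous_paths (Y k)"
    and Y_ordered: "AE \<omega> in M. \<forall>t\<ge>0. (\<lambda>k. Y k t \<omega>) \<in> weyl_chamber N"
    and L_boundary: "AE \<omega> in M. \<forall>t\<ge>0. L 0 t \<omega> = 0 \<and> L N t \<omega> = 0"
    and L_adapted: "1 \<le> k \<Longrightarrow> k < N \<Longrightarrow> adapted (L k)"
    and L_continuous: "1 \<le> k \<Longrightarrow> k < N \<Longrightarrow> continuous_paths (L k)"
    and L_start: "1 \<le> k \<Longrightarrow> k < N \<Longrightarrow> AE \<omega> in M. L k 0 \<omega> = 0"
    and L_mono: "1 \<le> k \<Longrightarrow> k < N \<Longrightarrow> AE \<omega> in M. mono_on {0..} (\<lambda>t. L k t \<omega>)"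
    and L_increase: "1 \<le> k \<Longrightarrow> k < N \<Longrightarrow>
      AE \<omega> in M. AE t in interval_measure (\<lambda>s. L k (max 0 s) \<omega>). 0 \<le> t \<longrightarrow> Y k t \<omega> = Y (Suc k) t \<omega>"
    and dynamics: "AE \<omega> in M. \<forall>t\<ge>0. \<forall>k\<in>{1..N}.
      Y k t \<omega> = Y k 0 \<omega> + g k * t + \<sigma> k * B k t \<omega> + qp k * L (k - 1) t \<omega> - qm k * L k t \<omega>"

end

theory Submission
  imports Defs
begin

text \<open>
  The argument is pathwise. Both systems have the same driving term, so the differences
  \<open>D\<^sub>k = Y\<^sub>k - Y'\<^sub>k\<close> have finite variation. With weights such that
  \<open>c\<^sub>k\<^sub>+\<^sub>1 q\<^sup>+\<^sub>k\<^sub>+\<^sub>1 = c\<^sub>k q\<^sup>-\<^sub>k\<close>, put \<open>\<Phi> = \<Sum>\<^sub>k c\<^sub>k (D\<^sub>k\<^sup>+)\<^sup>2\<close>.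
  In \<open>d\<Phi>\<close>, the factor of \<open>dL\<^sub>k\<close> is a positive multiple of \<open>D\<^sub>k\<^sub>+\<^sub>1\<^sup>+ - D\<^sub>k\<^sup>+\<close>, which is at most 0
  when \<open>Y\<^sub>k = Y\<^sub>k\<^sub>+\<^sub>1\<close>, because \<open>Y'\<^sub>k \<le> Y'\<^sub>k\<^sub>+\<^sub>1\<close>. By the inequalities between the parameters of
  collision, the factor of \<open>dL'\<^sub>k\<close> is at most a positive multiple of \<open>D\<^sub>k\<^sup>+ - D\<^sub>k\<^sub>+\<^sub>1\<^sup>+\<close>, which
  is at most 0 when \<open>Y'\<^sub>k = Y'\<^sub>k\<^sub>+\<^sub>1\<close>. So \<open>\<Phi>\<close> is nonincreasing, and it starts from 0.
\<close>

text \<open>One fixed sample path. \<open>w\<close> collects the initial value, drift and noise,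
  which the two systems share. \<open>increase\<close> keeps from the condition on the Stieltjes
  measure only a contact time in each interval of growth, which is what increment estimates
  use.\<close>

locale reflected_path =
  fixes N :: nat and qp qm :: "nat \<Rightarrow> real" and w y l :: "nat \<Rightarrow> real \<Rightarrow> real"
  assumes N_pos: "1 \<le> N"
    and parameters: "collision_parameters N qp qm"
    and continuous: "k \<in> {1..N} \<Longrightarrow> continuous_on {0..} (y k)"
    and ordered: "0 \<le> t \<Longrightarrow> 1 \<le> k \<Longrightarrow> k < N \<Longrightarrow> y k t \<le> y (Suc k) t"
    and boundary: "0 \<le> t \<Longrightarrow> l 0 t = 0" "0 \<le> t \<Longrightarrow> l N t = 0"
    and mono: "1 \<le> k \<Longrightarrow> k < N \<Longrightarrow> mono_on {0..} (l k)"
    and increase: "1 \<le> k \<Longrightarrow> k < N \<Longrightarrow> 0 \<le> s \<Longrightarrow> s \<le> t \<Longrightarrow> l k s < l k t \<Longrightarrow>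
      \<exists>r\<in>{s..t}. y k r = y (Suc k) r"
    and dynamics: "0 \<le> t \<Longrightarrow> k \<in> {1..N} \<Longrightarrow>
      y k t = w k t + qp k * l (k - 1) t - qm k * l k t"

section \<open>Elementary estimates for real functions and finite sums\<close>

lemma locally_nonincreasing_imp_le:
  fixes f :: "real \<Rightarrow> real"
  assumes "0 \<le> T" "0 < \<delta>"
    and loc: "\<And>s t. 0 \<le> s \<Longrightarrow> s \<le> t \<Longrightarrow> t \<le> T \<Longrightarrow> t - s < \<delta> \<Longrightarrow> f t \<le> f s"
  shows "f T \<le> f 0"
proof -
  obtain n where n: "T / \<delta> < real n" using reals_Archimedean2 by blast
  have "0 \<le> T / \<delta>" using assms by simp
  then have npos: "0 < real n" using n by linarith
  have step: "T / n < \<delta>" using n npos \<open>0 < \<delta>\<close> by (simp add: field_simps)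
  have "i \<le> n \<Longrightarrow> f (i * (T / n)) \<le> f 0" for i
  proof (induction i)
    case (Suc i)
    have le: "real (Suc i) * (T / n) \<le> real n * (T / n)"
      using Suc.prems \<open>0 \<le> T\<close> npos by (intro mult_right_mono) auto
    define d where "d = T / n"
    have "0 \<le> d" "d < \<delta>" "real n * d = T"
      using \<open>0 \<le> T\<close> npos step by (auto simp: d_def)
    then have "f (real (Suc i) * d) \<le> f (real i * d)"
      using le unfolding d_def[symmetric] by (intro loc) (auto simp: distrib_right)
    then show ?case using Suc unfolding d_def by simp
  qed simp
  from this[of n] npos show ?thesis by simp
qed

text \<open>Abel summation. The term at \<open>n\<close> is kept so that the induction goes through;
  for collision terms it vanishes at \<open>N\<close>.\<close>

lemma sum_by_parts_boundary:
  fixes p a b x :: "nat \<Rightarrow> real"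
  assumes "1 \<le> n" "x 0 = 0"
  shows "(\<Sum>k\<in>{1..n}. p k * (a k * x (k - 1) - b k * x k)) =
    (\<Sum>k\<in>{1..<n}. x k * (p (Suc k) * a (Suc k) - p k * b k)) - p n * b n * x n"
  using \<open>1 \<le> n\<close>
proof (induction n rule: dec_induct)
  case base
  then show ?case using \<open>x 0 = 0\<close> by simp
next
  case (step n)
  then show ?case by (simp add: algebra_simps)
qed

text \<open>The tangent inequality at \<open>y\<close> for the convex function
  \<open>max 0 u\<close> squared; it stands in for the chain rule.\<close>

lemma pos_part_square_convex:
  fixes x y :: real
  shows "(max 0 y)\<^sup>2 - (max 0 x)\<^sup>2 \<le> 2 * max 0 y * (y - x)"
proof (cases "0 \<le> y")
  case True
  show ?thesis
  proof (cases "0 \<le> x")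
    case nonneg: True
    have "0 \<le> (y - x)\<^sup>2" by simp
    then show ?thesis using True nonneg by (simp add: power2_eq_square algebra_simps)
  next
    case False
    then have "y * x \<le> 0" using True by (simp add: mult_nonneg_nonpos)
    moreover have "0 \<le> y * y" by simp
    ultimately have "y * y \<le> 2 * (y * y) - 2 * (y * x)" by linarith
    then show ?thesis using True False by (simp add: power2_eq_square algebra_simps)
  qed
qed simp

text \<open>
  The bound holds with the factor frozen at the right end point because \<open>h\<close> is nonpositive at
  some time of any interval on which \<open>l\<close> increases.
\<close>

lemma increment_le:
  fixes h l :: "real \<Rightarrow> real"
  assumes "mono_on {0..} l" "0 \<le> s" "s \<le> t"
    and touch: "l s < l t \<Longrightarrow> \<exists>r\<in>{s..t}. h r \<le> 0"
    and osc: "\<And>r. r \<in> {s..t} \<Longrightarrow> \<bar>h t - h r\<bar> \<le> e"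
  shows "(l t - l s) * h t \<le> e * (l t - l s)"
proof (cases "l s < l t")
  case True
  then obtain r where r: "r \<in> {s..t}" "h r \<le> 0" using touch by blast
  have "h t \<le> e" using osc[OF r(1)] r(2) by linarith
  then have "(l t - l s) * h t \<le> (l t - l s) * e" using True by (intro mult_left_mono) auto
  then show ?thesis by (simp add: mult.commute)
next
  case False
  moreover have "l s \<le> l t" using assms by (auto intro: mono_onD)
  ultimately show ?thesis by simp
qed

lemma uniform_oscillation:
  fixes h :: "nat \<Rightarrow> real \<Rightarrow> real"
  assumes "finite K" "\<And>k. k \<in> K \<Longrightarrow> continuous_on {0..T} (h k)" "0 < e"
  obtains \<delta> where "0 < \<delta>"
    "\<And>k s t. k \<in> K \<Longrightarrow> s \<in> {0..T} \<Longrightarrow> t \<in> {0..T} \<Longrightarrow> \<bar>t - s\<bar> < \<delta> \<Longrightarrow> \<bar>h k t - h k s\<bar> \<le> e"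
proof -
  have "\<exists>d>0. \<forall>s\<in>{0..T}. \<forall>t\<in>{0..T}. \<bar>t - s\<bar> < d \<longrightarrow> \<bar>h k t - h k s\<bar> < e" if "k \<in> K" for k
  proof -
    have "uniformly_continuous_on {0..T} (h k)"
      using assms(2)[OF that] by (rule compact_uniformly_continuous) simp
    then show ?thesis
      using \<open>0 < e\<close> unfolding uniformly_continuous_on_def dist_real_def by blast
  qed
  then obtain d where d: "\<And>k. k \<in> K \<Longrightarrow> 0 < d k"
    "\<And>k s t. k \<in> K \<Longrightarrow> s \<in> {0..T} \<Longrightarrow> t \<in> {0..T} \<Longrightarrow> \<bar>t - s\<bar> < d k \<Longrightarrow> \<bar>h k t - h k s\<bar> < e"
    by metis
  show thesis
  \<comment> \<open>The inserted 1 keeps the minimum meaningful for empty \<open>K\<close>, which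
    occurs when \<open>N = 1\<close>.\<close>
  proof (rule that[of "Min (insert 1 (d ` K))"])
    show "0 < Min (insert 1 (d ` K))" using d(1) \<open>finite K\<close> by (subst Min_gr_iff) auto
    fix k s t assume "k \<in> K" "s \<in> {0..T}" "t \<in> {0..T}" "\<bar>t - s\<bar> < Min (insert 1 (d ` K))"
    moreover from this have "\<bar>t - s\<bar> < d k" using \<open>finite K\<close> by (simp add: Min_gr_iff)
    ultimately show "\<bar>h k t - h k s\<bar> \<le> e" using d(2) by (simp add: less_imp_le)
  qed
qed

section \<open>Comparison of two deterministic paths\<close>

lemma reflected_path_comparison:
  assumes path: "reflected_path N qp qm w y l"
    and path': "reflected_path N qp' qm' w' y' l'"
    and w_eq: "\<And>k t. k \<in> {1..N} \<Longrightarrow> 0 \<le> t \<Longrightarrow> w k t = w' k t"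
    and qp_le: "\<And>k. k \<in> {1..N} \<Longrightarrow> qp k \<le> qp' k"
    and start: "\<And>k. k \<in> {1..N} \<Longrightarrow> y k 0 = y' k 0"
    and T: "0 \<le> T" and k: "k \<in> {1..N}"
  shows "y k T \<le> y' k T"
proof -
  interpret P: reflected_path N qp qm w y l by fact
  interpret P': reflected_path N qp' qm' w' y' l' by fact
  \<comment> \<open>Solution of the weight recursion with \<open>c 1 = 1\<close>, built from the
    parameters of the first system only.\<close>
  define c where "c k = (\<Prod>j\<in>{1..<k}. qm j / qp (Suc j))" for k
  define a where "a k = c k * qm k" for k
  define p where "p k t = max 0 (y k t - y' k t)" for k t
  define \<Phi> where "\<Phi> t = (\<Sum>k\<in>{1..N}. c k * (p k t)\<^sup>2)" for t
  \<comment> \<open>\<open>V\<close> controls the accumulated error; \<open>h k\<close> is half the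
    factor of \<open>dl k\<close> in \<open>d\<Phi>\<close>.\<close>
  define V where "V t = (\<Sum>k\<in>{1..<N}. l k t + l' k t)" for t
  define h where "h k t = a k * (p (Suc k) t - p k t)" for k t

  have q_pos: "0 < qp k" "0 < qm k" if "k \<in> {1..N}" for k
    using P.parameters that by (auto simp: collision_parameters_def)
  have c_pos: "0 < c k" if "k \<in> {1..N}" for k
    unfolding c_def using that by (intro prod_pos ballI divide_pos_pos q_pos) auto
  have a_pos: "0 < a k" if "k \<in> {1..<N}" for k
    using that c_pos[of k] q_pos[of k] by (simp add: a_def)
  have c_Suc: "c (Suc k) * qp (Suc k) = a k" if "k \<in> {1..<N}" for k
    using that q_pos[of "Suc k"] by (simp add: a_def c_def)
  have a_le: "a k \<le> c (Suc k) * qp' (Suc k)" if "k \<in> {1..<N}" for k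
    unfolding c_Suc[OF that, symmetric]
    using that qp_le c_pos[of "Suc k"] by (intro mult_left_mono) auto
  have a_ge: "c k * qm' k \<le> a k" if "k \<in> {1..<N}" for k
  proof -
    have "qp (Suc k) + qm k = 1" "qp' (Suc k) + qm' k = 1" "qp (Suc k) \<le> qp' (Suc k)"
      using that P.parameters P'.parameters qp_le by (auto simp: collision_parameters_def)
    then have "qm' k \<le> qm k" by linarith
    then show ?thesis unfolding a_def using that c_pos[of k] by (intro mult_left_mono) auto
  qed
  have p_nonneg: "0 \<le> p k t" for k t by (simp add: p_def)

  \<comment> \<open>Discrete form of \<open>d\<Phi>\<close>, without integrals. The factors are
    frozen at \<open>t\<close> because convexity is applied there.\<close>
  have increment: "\<Phi> t - \<Phi> s \<le>
      2 * (\<Sum>k\<in>{1..<N}. (l k t - l k s) * h k t + (l' k t - l' k s) * - h k t)"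
    if st: "0 \<le> s" "s \<le> t" for s t
  proof -
    define x where "x k = l k t - l k s" for k
    define x' where "x' k = l' k t - l' k s" for k
    have x0: "x 0 = 0" "x' 0 = 0" "x N = 0" "x' N = 0"
      using st P.boundary P'.boundary by (auto simp: x_def x'_def)
    have D: "(y k t - y' k t) - (y k s - y' k s) =
        (qp k * x (k - 1) - qm k * x k) - (qp' k * x' (k - 1) - qm' k * x' k)"
      if "k \<in> {1..N}" for k
      using that st P.dynamics[of t k] P.dynamics[of s k] P'.dynamics[of t k] P'.dynamics[of s k]
        w_eq[of k t] w_eq[of k s]
      by (simp add: x_def x'_def algebra_simps)
    have "\<Phi> t - \<Phi> s = (\<Sum>k\<in>{1..N}. c k * ((p k t)\<^sup>2 - (p k s)\<^sup>2))"
      by (simp add: \<Phi>_def sum_subtractf right_diff_distrib)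
    also have "\<dots> \<le> (\<Sum>k\<in>{1..N}. c k * (2 * p k t * ((y k t - y' k t) - (y k s - y' k s))))"
      unfolding p_def using c_pos
      by (intro sum_mono mult_left_mono pos_part_square_convex) (auto intro: less_imp_le)
    also have "\<dots> = 2 * ((\<Sum>k\<in>{1..N}. (c k * p k t) * (qp k * x (k - 1) - qm k * x k)) -
        (\<Sum>k\<in>{1..N}. (c k * p k t) * (qp' k * x' (k - 1) - qm' k * x' k)))"
      unfolding sum_subtractf[symmetric] sum_distrib_left
      by (intro sum.cong refl) (simp only: D mult_ac right_diff_distrib)
    \<comment> \<open>Summation by parts groups the terms by collision; the boundary terms drop out
      by \<open>x N = 0\<close> and \<open>x' N = 0\<close>.\<close>
    also have "\<dots> = 2 * (\<Sum>k\<in>{1..<N}.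
        x k * (c (Suc k) * p (Suc k) t * qp (Suc k) - c k * p k t * qm k) -
        x' k * (c (Suc k) * p (Suc k) t * qp' (Suc k) - c k * p k t * qm' k))"
      unfolding sum_by_parts_boundary[of N x, OF P.N_pos x0(1)]
        sum_by_parts_boundary[of N x', OF P.N_pos x0(2)] x0 by (simp add: sum_subtractf)
    also have "\<dots> \<le> 2 * (\<Sum>k\<in>{1..<N}. x k * h k t + x' k * - h k t)"
    proof (intro mult_left_mono sum_mono)
      fix k assume k: "k \<in> {1..<N}"
      have "0 \<le> x' k"
        using mono_onD[OF P'.mono[of k], of s t] k st by (simp add: x'_def)
      moreover have "h k t \<le> c (Suc k) * p (Suc k) t * qp' (Suc k) - c k * p k t * qm' k"
        using mult_right_mono[OF a_le[OF k] p_nonneg[of "Suc k" t]]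
          mult_right_mono[OF a_ge[OF k] p_nonneg[of k t]]
        by (simp add: h_def algebra_simps)
      ultimately have "x' k * h k t \<le>
          x' k * (c (Suc k) * p (Suc k) t * qp' (Suc k) - c k * p k t * qm' k)"
        by (intro mult_left_mono)
      moreover have "c (Suc k) * p (Suc k) t * qp (Suc k) - c k * p k t * qm k = h k t"
        using c_Suc[OF k] by (simp add: h_def a_def algebra_simps)
      ultimately show "x k * (c (Suc k) * p (Suc k) t * qp (Suc k) - c k * p k t * qm k) -
          x' k * (c (Suc k) * p (Suc k) t * qp' (Suc k) - c k * p k t * qm' k)
          \<le> x k * h k t + x' k * - h k t"
        by simp
    qed simp
    finally show ?thesis by (simp add: x_def x'_def)
  qed

  have touch: "\<exists>r\<in>{s..t}. h k r \<le> 0"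
    if st: "k \<in> {1..<N}" "0 \<le> s" "s \<le> t" "l k s < l k t" for k s t
  proof -
    obtain r where r: "r \<in> {s..t}" "y k r = y (Suc k) r"
      using P.increase[of k s t] st by auto
    moreover have "y' k r \<le> y' (Suc k) r" using P'.ordered[of r k] st r by auto
    ultimately have "p (Suc k) r \<le> p k r" by (simp add: p_def)
    then have "h k r \<le> 0" using a_pos[OF st(1)] by (simp add: h_def mult_le_0_iff)
    then show ?thesis using r by blast
  qed
  have touch': "\<exists>r\<in>{s..t}. - h k r \<le> 0"
    if st: "k \<in> {1..<N}" "0 \<le> s" "s \<le> t" "l' k s < l' k t" for k s t
  proof -
    obtain r where r: "r \<in> {s..t}" "y' k r = y' (Suc k) r"
      using P'.increase[of k s t] st by auto
    moreover have "y k r \<le> y (Suc k) r" using P.ordered[of r k] st r by auto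
    ultimately have "p k r \<le> p (Suc k) r" by (simp add: p_def)
    then have "0 \<le> h k r" using a_pos[OF st(1)] by (simp add: h_def)
    then show ?thesis using r by auto
  qed
  have h_cont: "continuous_on {0..T} (h k)" if "k \<in> {1..<N}" for k
  proof -
    have *: "continuous_on {0..T} (y j)" "continuous_on {0..T} (y' j)" if "j \<in> {1..N}" for j
      using P.continuous[OF that] P'.continuous[OF that] by (auto elim: continuous_on_subset)
    show ?thesis unfolding h_def p_def
      using that by (intro continuous_intros *) auto
  qed

  \<comment> \<open>On intervals where every \<open>h k\<close> oscillates by at most
    \<open>e\<close>, \<open>\<Phi>\<close> grows by at most \<open>2 * e\<close> times the growth
    of \<open>V\<close>. Subtracting \<open>2 * e * V\<close> thus gives a locally nonincreasing
    function.\<close>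
  have bound: "\<Phi> T \<le> 2 * e * (V T - V 0)" if e: "0 < e" for e
  proof -
    obtain \<delta> where \<delta>: "0 < \<delta>"
      "\<And>k s t. k \<in> {1..<N} \<Longrightarrow> s \<in> {0..T} \<Longrightarrow> t \<in> {0..T} \<Longrightarrow> \<bar>t - s\<bar> < \<delta> \<Longrightarrow>
        \<bar>h k t - h k s\<bar> \<le> e"
      using uniform_oscillation[of "{1..<N}" T h e] h_cont e by auto
    have "\<Phi> T - 2 * e * V T \<le> \<Phi> 0 - 2 * e * V 0"
    proof (rule locally_nonincreasing_imp_le[OF T \<delta>(1)])
      fix s t assume st: "0 \<le> s" "s \<le> t" "t \<le> T" "t - s < \<delta>"
      have "(l k t - l k s) * h k t + (l' k t - l' k s) * - h k t
          \<le> e * (l k t - l k s) + e * (l' k t - l' k s)" if k: "k \<in> {1..<N}" for k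
      proof (rule add_mono)
        have osc: "\<bar>h k t - h k r\<bar> \<le> e" if "r \<in> {s..t}" for r
          using that st by (intro \<delta>(2)[OF k]) auto
        have mono: "mono_on {0..} (l k)" "mono_on {0..} (l' k)"
          using P.mono P'.mono k by auto
        show "(l k t - l k s) * h k t \<le> e * (l k t - l k s)"
          by (rule increment_le[OF mono(1) st(1,2) touch[OF k st(1,2)] osc])
        show "(l' k t - l' k s) * - h k t \<le> e * (l' k t - l' k s)"
        proof (rule increment_le[OF mono(2) st(1,2) touch'[OF k st(1,2)]])
          show "\<bar>- h k t - - h k r\<bar> \<le> e" if "r \<in> {s..t}" for r
            using osc[OF that] by simp
        qed
      qed
      then have "(\<Sum>k\<in>{1..<N}. (l k t - l k s) * h k t + (l' k t - l' k s) * - h k t)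
          \<le> (\<Sum>k\<in>{1..<N}. e * (l k t - l k s) + e * (l' k t - l' k s))"
        by (rule sum_mono)
      also have "\<dots> = e * (V t - V s)"
        unfolding V_def sum_subtractf[symmetric] sum_distrib_left
        by (intro sum.cong) (auto simp: algebra_simps)
      finally show "\<Phi> t - 2 * e * V t \<le> \<Phi> s - 2 * e * V s"
        using increment[OF st(1,2)] by (simp add: algebra_simps)
    qed
    moreover have "\<Phi> 0 = 0" unfolding \<Phi>_def p_def using start by simp
    ultimately show ?thesis by (simp add: algebra_simps)
  qed
  have "\<Phi> T \<le> 0"
  proof (rule ccontr)
    define C where "C = 2 * (V T - V 0)"
    have bound_C: "\<Phi> T \<le> e * C" if "0 < e" for e
      using bound[OF that] by (simp add: C_def mult_ac)
    assume "\<not> \<Phi> T \<le> 0"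
    then have pos: "0 < \<Phi> T" by simp
    \<comment> \<open>Positivity of \<open>C\<close> makes the next choice of \<open>e\<close>
      legitimate; that choice gives \<open>\<Phi> T \<le> \<Phi> T / 2\<close>.\<close>
    then have "0 < C" using bound_C[of 1] by simp
    then show False using bound_C[of "\<Phi> T / (2 * C)"] pos by simp
  qed
  moreover have nonneg: "0 \<le> c j * (p j T)\<^sup>2" if "j \<in> {1..N}" for j
    using c_pos[OF that] by simp
  ultimately have "\<Phi> T = 0" unfolding \<Phi>_def by (intro antisym sum_nonneg)
  then have "c k * (p k T)\<^sup>2 = 0"
    using k nonneg unfolding \<Phi>_def by (subst (asm) sum_nonneg_eq_0_iff) auto
  then show ?thesis using c_pos[OF k] by (simp add: p_def)
qed

section \<open>From processes to paths\<close>

text \<open>If \<open>P\<close> failed throughout \<open>{s<..t}\<close>, this interval would be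
  null, yet its Stieltjes mass is \<open>f t - f s\<close>.\<close>

lemma AE_interval_measure_ex:
  fixes f :: "real \<Rightarrow> real"
  assumes f: "mono_on {0..} f" "continuous_on {0..} f"
    and st: "0 \<le> s" "s \<le> t" "f s < f t"
    and AE: "AE r in interval_measure (\<lambda>r. f (max 0 r)). 0 \<le> r \<longrightarrow> P r"
  shows "\<exists>r\<in>{s<..t}. P r"
proof (rule ccontr)
  let ?F = "\<lambda>r. f (max 0 r)"
  assume no: "\<not> (\<exists>r\<in>{s<..t}. P r)"
  \<comment> \<open>Constant continuation to negative times gives a continuous nondecreasing
    function on the whole line, as the mass formula requires.\<close>
  have "continuous_on UNIV ?F"
    by (rule continuous_on_compose2[OF f(2)]) (auto intro!: continuous_intros)
  then have cont: "continuous (at_right r) ?F" for r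
    by (metis UNIV_I continuous_on_eq_continuous_within continuous_within_subset subset_UNIV)
  have "emeasure (interval_measure ?F) {s<..t} = ennreal (?F t - ?F s)"
    using st(2) by (rule emeasure_interval_measure_Ioc) (auto intro: mono_onD[OF f(1)] cont)
  moreover have "AE r in interval_measure ?F. r \<notin> {s<..t}"
    using AE by (rule eventually_mono) (use no st in auto)
  then have "emeasure (interval_measure ?F) {s<..t} = 0"
    by (subst (asm) AE_iff_measurable[where N = "{s<..t}"]) auto
  ultimately show False using st by (simp add: ennreal_eq_0_iff)
qed

context competing_brownian_particles
begin

text \<open>Only finitely many indices occur, so all path properties hold off one common null
  set.\<close>

lemma AE_reflected_path:
  "AE \<omega> in M. reflected_path N qp qm
     (\<lambda>k t. Y k 0 \<omega> + g k * t + \<sigma> k * B k t \<omega>) (\<lambda>k t. Y k t \<omega>) (\<lambda>k t. L k t \<omega>)"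
proof -
  have "AE \<omega> in M. \<forall>k\<in>{1..N}. continuous_on {0..} (\<lambda>t. Y k t \<omega>)"
    using Y_continuous by (intro AE_finite_allI) (auto simp: continuous_paths_def)
  moreover have "AE \<omega> in M. \<forall>k\<in>{1..<N}. continuous_on {0..} (\<lambda>t. L k t \<omega>)"
    using L_continuous by (intro AE_finite_allI) (auto simp: continuous_paths_def)
  moreover have "AE \<omega> in M. \<forall>k\<in>{1..<N}. mono_on {0..} (\<lambda>t. L k t \<omega>)"
    using L_mono by (intro AE_finite_allI) auto
  moreover have "AE \<omega> in M. \<forall>k\<in>{1..<N}.
      AE t in interval_measure (\<lambda>s. L k (max 0 s) \<omega>). 0 \<le> t \<longrightarrow> Y k t \<omega> = Y (Suc k) t \<omega>"
    using L_increase by (intro AE_finite_allI) auto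
  ultimately show ?thesis
    using Y_ordered L_boundary dynamics
  proof eventually_elim
    case (elim \<omega>)
    show ?case
    proof (rule reflected_path.intro)
      fix k s t assume "1 \<le> k" "k < N" and st: "0 \<le> s" "s \<le> t" "L k s \<omega> < L k t \<omega>"
      then have k: "k \<in> {1..<N}" by simp
      have "\<exists>r\<in>{s<..t}. Y k r \<omega> = Y (Suc k) r \<omega>"
        by (rule AE_interval_measure_ex[OF elim(3)[rule_format, OF k] elim(2)[rule_format, OF k]
              st elim(4)[rule_format, OF k]])
      then show "\<exists>r\<in>{s..t}. Y k r \<omega> = Y (Suc k) r \<omega>" by force
    next
      fix k and t :: real assume "0 \<le> t" "k \<in> {1..N}"
      then show "Y k t \<omega> = Y k 0 \<omega> + g k * t + \<sigma> k * B k t \<omega>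
          + qp k * L (k - 1) t \<omega> - qm k * L k t \<omega>"
        by (rule elim(7)[rule_format])
    next
      fix k and t :: real assume "0 \<le> t" "1 \<le> k" "k < N"
      then show "Y k t \<omega> \<le> Y (Suc k) t \<omega>"
        using elim(5) by (simp add: weyl_chamber_def)
    next
      fix t :: real assume "0 \<le> t"
      then show "L 0 t \<omega> = 0" "L N t \<omega> = 0" using elim(6) by simp_all
    next
      fix k assume "k \<in> {1..N}"
      then show "continuous_on {0..} (\<lambda>t. Y k t \<omega>)" using elim(1) by blast
    next
      fix k assume "1 \<le> k" "k < N"
      then show "mono_on {0..} (\<lambda>t. L k t \<omega>)" using elim(3) by simp
    qed (fact N_pos collision)+
  qed
qed

end

theorem corollary3p12:
  fixes M :: "'a measure" and F :: "real \<Rightarrow> 'a measure" and N :: nat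
    and g \<sigma> qp qm qp' qm' :: "nat \<Rightarrow> real"
    and B Y L Y' L' :: "nat \<Rightarrow> real \<Rightarrow> 'a \<Rightarrow> real"
  assumes "competing_brownian_particles M F N g \<sigma> qp qm B Y L"
    and "competing_brownian_particles M F N g \<sigma> qp' qm' B Y' L'"
    and "\<forall>n\<in>{1..N}. qp n \<le> qp' n"
    and "AE \<omega> in M. \<forall>k\<in>{1..N}. Y k 0 \<omega> = Y' k 0 \<omega>"
  shows "AE \<omega> in M. \<forall>t\<ge>0. \<forall>k\<in>{1..N}. Y k t \<omega> \<le> Y' k t \<omega>"
  using competing_brownian_particles.AE_reflected_path[OF assms(1)]
    competing_brownian_particles.AE_reflected_path[OF assms(2)] assms(4)
proof eventually_elim
  case (elim \<omega>)
  show ?case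
  proof (intro allI impI ballI)
    fix t :: real and k assume "0 \<le> t" "k \<in> {1..N}"
    \<comment> \<open>Equal initial values are used twice: for the start of the paths and for the
      equality of the driving terms, which contain them.\<close>
    with elim(3) assms(3) show "Y k t \<omega> \<le> Y' k t \<omega>"
      by (intro reflected_path_comparison[OF elim(1,2)]) auto
  qed
qed

end
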